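(* Let $(X,\|\cdot\|)$ be a Banach space, let $C\subset X$ be nonempty, closed, bounded and convex, let $p\ge1$ be real, let $\alpha=(\alpha_1,\alpha_2)$ with $\alpha_1,\alpha_2>0$ and $\alpha_1+\alpha_2=1$, and let $T:C\to C$ be $(\alpha,p)$-nonexpansive. If $\alpha_2^p\le\alpha_1$, then $T$ has an approximate fixed point sequence. If moreover $(C^2,\|\cdot\|_{\alpha,p})$ has the fixed point property for nonexpansive maps and $\alpha_2^p\le\alpha_1$, then $T$ has a fixed point.
   Context: For $p\in[1,\infty)$ and $\alpha=(\alpha_1,\alpha_2)$, a map $T:C\to C$ is $(\alpha,p)$-nonexpansive if $\alpha_1\|Tx-Ty\|^p+\alpha_2\|T^2x-T^2y\|^p\le\|x-y\|^p$ for all $x,y\in C$, where $T^2=T\circ T$. An approximate fixed point sequence for $T$ is a sequence $(x_n)_n$ in $C$ with $\|Tx_n-x_n\|\to0$. The norm $\|\cdot\|_{\alpha,p}$ on $X^2$ is $\|(x,y)\|_{\alpha,p}:=(\alpha_1\|x\|^p+\alpha_2\|y\|^p)^{1/p}$. The set $(C^2,\|\cdot\|_{\alpha,p})$ has the fixed point property for nonexpansive maps if every map $J:C^2\to C^2$ that is nonexpansive (i.e. $1$-Lipschitz) with respect to $\|\cdot\|_{\alpha,p}$ has a fixed point. *)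

theory Defs
  imports "HOL-Analysis.Analysis"
begin

text \<open>
  Self-maps of a set \<open>C\<close> are total functions \<open>T\<close> with \<open>T \<in> C \<rightarrow> C\<close>; only their values on \<open>C\<close> matter.
\<close>

definition mean_nonexpansive_on ::
    "real \<Rightarrow> real \<Rightarrow> real \<Rightarrow> 'a::real_normed_vector set \<Rightarrow> ('a \<Rightarrow> 'a) \<Rightarrow> bool" where
  "mean_nonexpansive_on \<alpha>1 \<alpha>2 p C T \<longleftrightarrow>
     (\<forall>x\<in>C. \<forall>y\<in>C.
        \<alpha>1 * norm (T x - T y) powr p + \<alpha>2 * norm ((T ^^ 2) x - (T ^^ 2) y) powr p
          \<le> norm (x - y) powr p)"

definition approx_fixed_point_seq ::
    "'a::real_normed_vector set \<Rightarrow> ('a \<Rightarrow> 'a) \<Rightarrow> (nat \<Rightarrow> 'a) \<Rightarrow> bool" where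
  "approx_fixed_point_seq C T x \<longleftrightarrow>
     (\<forall>n. x n \<in> C) \<and> (\<lambda>n. norm (T (x n) - x n)) \<longlonglongrightarrow> 0"

text \<open>
  This norm on \<open>X\<^sup>2\<close> is not the library's Euclidean norm of the product type.
\<close>

definition pair_norm ::
    "real \<Rightarrow> real \<Rightarrow> real \<Rightarrow> 'a::real_normed_vector \<times> 'a \<Rightarrow> real" where
  "pair_norm \<alpha>1 \<alpha>2 p z = (\<alpha>1 * norm (fst z) powr p + \<alpha>2 * norm (snd z) powr p) powr (1 / p)"

definition nonexpansive_wrt :: "('b::minus \<Rightarrow> real) \<Rightarrow> 'b set \<Rightarrow> ('b \<Rightarrow> 'b) \<Rightarrow> bool" where
  "nonexpansive_wrt N S J \<longleftrightarrow> (\<forall>u\<in>S. \<forall>v\<in>S. N (J u - J v) \<le> N (u - v))"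

definition fixed_point_property :: "('b::minus \<Rightarrow> real) \<Rightarrow> 'b set \<Rightarrow> bool" where
  "fixed_point_property N S \<longleftrightarrow>
     (\<forall>J. J \<in> S \<rightarrow> S \<and> nonexpansive_wrt N S J \<longrightarrow> (\<exists>u\<in>S. J u = u))"

end

theory Submission
  imports Defs
begin

text \<open>
  Convexity of \<open>t \<mapsto> t powr p\<close> makes the averaged map \<open>S = \<alpha>1 T + \<alpha>2 T\<^sup>2\<close> nonexpansive, so it has
  approximate fixed points by Banach's theorem. For the same reason the map
  \<open>(x, y) \<mapsto> (T w, T\<^sup>2 w)\<close> with \<open>w = \<alpha>1 x + \<alpha>2 y\<close> is nonexpansive on \<open>C\<^sup>2\<close>, and if it fixes \<open>(x, y)\<close>
  then \<open>S w = w\<close>. When \<open>S w = w\<close>, the difference \<open>w - T w\<close> equals \<open>\<alpha>2 (T\<^sup>2 w - T w)\<close>, so mean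
  nonexpansiveness at the pair \<open>w, T w\<close> reads
  \<open>\<alpha>2 \<parallel>T\<^sup>2 w - T\<^sup>3 w\<parallel>\<^sup>p \<le> (\<alpha>2\<^sup>p - \<alpha>1) \<parallel>T\<^sup>2 w - T w\<parallel>\<^sup>p \<le> 0\<close>: the point \<open>T\<^sup>2 w\<close> is fixed by \<open>T\<close>.
  An approximate version of this computation gives the approximate fixed points of \<open>T\<close>.
\<close>

section \<open>Convexity and continuity of real powers\<close>

lemma powr_convex_nonneg:
  fixes p :: real
  assumes "p \<ge> 1"
  shows "convex_on {0..} (\<lambda>x. x powr p)"
proof -
  \<comment> \<open>This settles the case where an endpoint is 0: as \<open>0 powr p = 0\<close>,
    convexity there reduces to scaling, and \<open>t powr p \<le> t\<close> because
    \<open>p \<ge> 1\<close> and \<open>t < 1\<close>. Positive endpoints are covered by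
    \<open>powr_convex\<close>.\<close>
  have scale: "(t * x) powr p \<le> t * x powr p" if "0 < t" "t < 1" "0 \<le> x" for t x :: real
  proof -
    have "t powr p \<le> t powr 1"
      using that assms by (intro powr_mono') auto
    then show ?thesis
      using that by (simp add: powr_mult mult_right_mono)
  qed
  show ?thesis
  proof (rule convex_onI)
    fix t x y :: real
    assume t: "0 < t" "t < 1" and xy: "x \<in> {0..}" "y \<in> {0..}"
    show "((1 - t) *\<^sub>R x + t *\<^sub>R y) powr p \<le> (1 - t) * x powr p + t * y powr p"
    proof (cases "x = 0 \<or> y = 0")
      case True
      then show ?thesis
        using scale[of t y] scale[of "1 - t" x] t xy by auto
    next
      case False
      then show ?thesis
        using convex_onD[OF powr_convex[OF assms], of t x y] t xy by auto
    qed
  qed simp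
qed

lemma weighted_mean_powr_le:
  fixes p \<alpha>1 \<alpha>2 a b :: real
  assumes "p \<ge> 1" "\<alpha>1 \<ge> 0" "\<alpha>2 \<ge> 0" "\<alpha>1 + \<alpha>2 = 1" "a \<ge> 0" "b \<ge> 0"
  shows "(\<alpha>1 * a + \<alpha>2 * b) powr p \<le> \<alpha>1 * a powr p + \<alpha>2 * b powr p"
proof -
  have \<alpha>1: "\<alpha>1 = 1 - \<alpha>2" and "\<alpha>2 \<le> 1"
    using assms by simp_all
  show ?thesis
    unfolding \<alpha>1
    using convex_onD[OF powr_convex_nonneg[OF \<open>p \<ge> 1\<close>], of \<alpha>2 a b] \<open>\<alpha>2 \<le> 1\<close> assms(3,5,6)
    by simp
qed

lemma norm_combination_powr_le:
  fixes x y :: "'a::real_normed_vector" and p \<alpha>1 \<alpha>2 :: real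
  assumes "p \<ge> 1" "\<alpha>1 \<ge> 0" "\<alpha>2 \<ge> 0" "\<alpha>1 + \<alpha>2 = 1"
  shows "norm (\<alpha>1 *\<^sub>R x + \<alpha>2 *\<^sub>R y) powr p \<le> \<alpha>1 * norm x powr p + \<alpha>2 * norm y powr p"
proof -
  have "norm (\<alpha>1 *\<^sub>R x + \<alpha>2 *\<^sub>R y) \<le> \<alpha>1 * norm x + \<alpha>2 * norm y"
    using norm_triangle_ineq[of "\<alpha>1 *\<^sub>R x" "\<alpha>2 *\<^sub>R y"] assms by simp
  then have "norm (\<alpha>1 *\<^sub>R x + \<alpha>2 *\<^sub>R y) powr p \<le> (\<alpha>1 * norm x + \<alpha>2 * norm y) powr p"
    using assms by (intro powr_mono2) auto
  also have "\<dots> \<le> \<alpha>1 * norm x powr p + \<alpha>2 * norm y powr p"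
    using assms by (intro weighted_mean_powr_le) auto
  finally show ?thesis .
qed

lemma powr_le_powr_iff:
  fixes a b p :: real
  assumes "p > 0" "a \<ge> 0" "b \<ge> 0"
  shows "a powr p \<le> b powr p \<longleftrightarrow> a \<le> b"
  using assms powr_mono2[of p a b] powr_less_mono2[of p b a] by force

text \<open>For \<open>p > 1\<close> the power is not uniformly continuous on the whole half-line.
  The common bound \<open>M\<close> confines both sequences to a compact interval, where it
  is.\<close>

lemma powr_diff_tendsto_zero:
  fixes s t :: "nat \<Rightarrow> real" and p :: real
  assumes "p > 0" and s: "\<And>n. 0 \<le> s n" "\<And>n. s n \<le> M" and t: "\<And>n. 0 \<le> t n" "\<And>n. t n \<le> M"
    and lim: "(\<lambda>n. s n - t n) \<longlonglongrightarrow> 0"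
  shows "(\<lambda>n. s n powr p - t n powr p) \<longlonglongrightarrow> 0"
proof -
  have "continuous_on {0..M} (\<lambda>x. x powr p)"
    using \<open>p > 0\<close> by (intro continuous_on_powr' continuous_intros) auto
  then have "uniformly_continuous_on {0..M} (\<lambda>x. x powr p)"
    by (intro compact_uniformly_continuous compact_Icc)
  moreover have "(\<lambda>n. dist (s n) (t n)) \<longlonglongrightarrow> 0"
    using lim by (simp add: dist_real_def tendsto_rabs_zero)
  ultimately have "(\<lambda>n. dist (s n powr p) (t n powr p)) \<longlonglongrightarrow> 0"
    using s t unfolding uniformly_continuous_on_sequentially by simp
  then show ?thesis
    by (simp add: dist_real_def tendsto_rabs_zero_iff)
qed

lemma powr_tendsto_zero_cancel:
  fixes f :: "nat \<Rightarrow> real" and p :: real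
  assumes "p > 0" "\<And>n. 0 \<le> f n" "(\<lambda>n. f n powr p) \<longlonglongrightarrow> 0"
  shows "f \<longlonglongrightarrow> 0"
proof -
  have "(\<lambda>n. (f n powr p) powr (1 / p)) \<longlonglongrightarrow> 0 powr (1 / p)"
    using assms by (intro tendsto_powr2) auto
  then show ?thesis
    using assms by (simp add: powr_powr)
qed

section \<open>Approximate fixed points of nonexpansive self-maps\<close>

lemma nonexpansive_approx_fixed_point_seq:
  fixes C :: "'a::banach set" and S :: "'a \<Rightarrow> 'a"
  assumes "C \<noteq> {}" "closed C" "bounded C" "convex C" and S: "S \<in> C \<rightarrow> C"
    and nonexp: "\<And>x y. x \<in> C \<Longrightarrow> y \<in> C \<Longrightarrow> norm (S x - S y) \<le> norm (x - y)"
  shows "\<exists>w. approx_fixed_point_seq C S w"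
proof -
  obtain a where a: "a \<in> C"
    using \<open>C \<noteq> {}\<close> by blast
  obtain B where B: "\<And>x. x \<in> C \<Longrightarrow> dist a x \<le> B"
    using \<open>bounded C\<close> bounded_any_center by metis
  define t where "t n = inverse (real (Suc n))" for n
  have t: "0 < t n" "t n \<le> 1" for n
    by (auto simp: t_def inverse_le_1_iff)
  \<comment> \<open>Pulling \<open>S\<close> towards the anchor \<open>a\<close> with weight
    \<open>t n\<close> gives a contraction of factor \<open>1 - t n\<close>. At its fixed point,
    \<open>S\<close> displaces by \<open>t n * dist a (S (w n)) \<le> t n * B\<close>, which tends
    to 0.\<close>
  have "\<exists>x\<in>C. (1 - t n) *\<^sub>R S x + t n *\<^sub>R a = x" for n
  proof -
    have "\<exists>!x\<in>C. (1 - t n) *\<^sub>R S x + t n *\<^sub>R a = x"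
    proof (rule Banach_fix)
      show "complete C"
        using \<open>closed C\<close> by (simp add: complete_eq_closed)
      show "(\<lambda>x. (1 - t n) *\<^sub>R S x + t n *\<^sub>R a) ` C \<subseteq> C"
        using S a t[of n] \<open>convex C\<close> by (auto intro!: convexD simp: Pi_iff)
      show "dist ((1 - t n) *\<^sub>R S x + t n *\<^sub>R a) ((1 - t n) *\<^sub>R S y + t n *\<^sub>R a)
          \<le> (1 - t n) * dist x y" if "x \<in> C" "y \<in> C" for x y
        using nonexp[OF that] t[of n]
        by (simp add: dist_norm mult_left_mono flip: scaleR_diff_right)
    qed (use t[of n] \<open>C \<noteq> {}\<close> in auto)
    then show ?thesis
      by blast
  qed
  then obtain w where w: "\<And>n. w n \<in> C" "\<And>n. (1 - t n) *\<^sub>R S (w n) + t n *\<^sub>R a = w n"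
    by metis
  have "norm (S (w n) - w n) \<le> t n * B" for n
  proof -
    have "S (w n) - w n = t n *\<^sub>R (S (w n) - a)"
      using w(2)[of n] by (simp add: algebra_simps)
    then have "norm (S (w n) - w n) = t n * dist a (S (w n))"
      using t[of n] by (simp add: dist_norm norm_minus_commute)
    also have "\<dots> \<le> t n * B"
      using B[of "S (w n)"] S w(1) t[of n] by (intro mult_left_mono) auto
    finally show ?thesis .
  qed
  moreover have "(\<lambda>n. t n * B) \<longlonglongrightarrow> 0"
    unfolding t_def by (intro tendsto_mult_left_zero LIMSEQ_inverse_real_of_nat)
  ultimately have "(\<lambda>n. norm (S (w n) - w n)) \<longlonglongrightarrow> 0"
    by (intro Lim_null_comparison[of "\<lambda>n. norm (S (w n) - w n)" "\<lambda>n. t n * B"]) auto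
  then show ?thesis
    using w(1) unfolding approx_fixed_point_seq_def by blast
qed

section \<open>Mean nonexpansive maps and their averaged map\<close>

locale mean_nonexpansive =
  fixes C :: "'a::banach set" and T :: "'a \<Rightarrow> 'a" and p \<alpha>1 \<alpha>2 :: real
  assumes convex_C: "convex C" and p: "p \<ge> 1"
    and \<alpha>: "\<alpha>1 > 0" "\<alpha>2 > 0" "\<alpha>1 + \<alpha>2 = 1"
    and T: "T \<in> C \<rightarrow> C"
    and mean: "mean_nonexpansive_on \<alpha>1 \<alpha>2 p C T"
begin

lemma T_in: "x \<in> C \<Longrightarrow> T x \<in> C"
  using T by blast

lemma combination_in: "x \<in> C \<Longrightarrow> y \<in> C \<Longrightarrow> \<alpha>1 *\<^sub>R x + \<alpha>2 *\<^sub>R y \<in> C"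
  using convex_C \<alpha> by (simp add: convexD)

lemma mean_ineq:
  assumes "x \<in> C" "y \<in> C"
  shows "\<alpha>1 * norm (T x - T y) powr p + \<alpha>2 * norm (T (T x) - T (T y)) powr p
    \<le> norm (x - y) powr p"
  using mean assms unfolding mean_nonexpansive_on_def by (simp add: numeral_2_eq_2)

definition averaged :: "'a \<Rightarrow> 'a" where
  "averaged x = \<alpha>1 *\<^sub>R T x + \<alpha>2 *\<^sub>R T (T x)"

lemma averaged_in: "averaged \<in> C \<rightarrow> C"
  unfolding averaged_def by (auto intro: combination_in T_in)

lemma averaged_nonexpansive:
  assumes "x \<in> C" "y \<in> C"
  shows "norm (averaged x - averaged y) \<le> norm (x - y)"
proof -
  have "averaged x - averaged y = \<alpha>1 *\<^sub>R (T x - T y) + \<alpha>2 *\<^sub>R (T (T x) - T (T y))"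
    by (simp add: averaged_def algebra_simps)
  then have "norm (averaged x - averaged y) powr p
      \<le> \<alpha>1 * norm (T x - T y) powr p + \<alpha>2 * norm (T (T x) - T (T y)) powr p"
    using norm_combination_powr_le[of p \<alpha>1 \<alpha>2] p \<alpha> by simp
  also have "\<dots> \<le> norm (x - y) powr p"
    by (rule mean_ineq[OF assms])
  finally show ?thesis
    using p by (simp add: powr_le_powr_iff)
qed

text \<open>This is the mean inequality at \<open>w\<close> and \<open>T w\<close>, with the
  coefficient \<open>\<alpha>1\<close> of the first term lowered to \<open>\<alpha>2 powr p\<close>
  so that it merges into the power. Nothing is assumed about \<open>averaged w\<close>, so the bound
  serves both the exact and the approximate argument.\<close>

lemma third_iterate_le:
  assumes "w \<in> C" "\<alpha>2 powr p \<le> \<alpha>1"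
  shows "\<alpha>2 * norm (T (T (T w)) - T (T w)) powr p
    \<le> norm (w - T w) powr p - (\<alpha>2 * norm (T (T w) - T w)) powr p"
proof -
  have "(\<alpha>2 * norm (T (T w) - T w)) powr p = \<alpha>2 powr p * norm (T (T w) - T w) powr p"
    using \<alpha> by (simp add: powr_mult)
  also have "\<dots> \<le> \<alpha>1 * norm (T w - T (T w)) powr p"
    using assms(2) by (simp add: mult_right_mono norm_minus_commute)
  finally show ?thesis
    using mean_ineq[OF assms(1) T_in[OF assms(1)]]
    by (simp add: norm_minus_commute[of "T (T (T w))"])
qed

text \<open>Since the weights sum to 1, \<open>w - T w\<close> is exactly
  \<open>\<alpha>2 *\<^sub>R (T (T w) - T w)\<close> minus the displacement
  \<open>averaged w - w\<close>. The latter is the error term in bounding the right-hand side of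
  \<open>third_iterate_le\<close>.\<close>

lemma norm_diff_le_averaged:
  "norm (w - T w) \<le> \<alpha>2 * norm (T (T w) - T w) + norm (averaged w - w)"
proof -
  have "T w = \<alpha>1 *\<^sub>R T w + \<alpha>2 *\<^sub>R T w"
    using \<alpha> by (metis scaleR_add_left scaleR_one)
  then have "w - T w = \<alpha>2 *\<^sub>R (T (T w) - T w) - (averaged w - w)"
    by (simp add: averaged_def algebra_simps)
  then have "norm (w - T w) \<le> norm (\<alpha>2 *\<^sub>R (T (T w) - T w)) + norm (averaged w - w)"
    using norm_triangle_ineq4 by metis
  then show ?thesis
    using \<alpha> by simp
qed

lemma fixed_point_if_averaged_fixed_point:
  assumes "w \<in> C" "averaged w = w" "\<alpha>2 powr p \<le> \<alpha>1"
  shows "T (T (T w)) = T (T w)"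
proof -
  have "norm (w - T w) powr p \<le> (\<alpha>2 * norm (T (T w) - T w)) powr p"
    using norm_diff_le_averaged[of w] assms p by (intro powr_mono2) auto
  then have "\<alpha>2 * norm (T (T (T w)) - T (T w)) powr p \<le> 0"
    using third_iterate_le[OF assms(1,3)] by simp
  then show ?thesis
    using \<alpha> by (simp add: mult_le_0_iff)
qed

lemma approx_fixed_point_seq_if_averaged:
  assumes "bounded C" and w: "approx_fixed_point_seq C averaged w" and le: "\<alpha>2 powr p \<le> \<alpha>1"
  shows "approx_fixed_point_seq C T (\<lambda>n. T (T (w n)))"
proof -
  define \<epsilon> where "\<epsilon> = (\<lambda>n. norm (averaged (w n) - w n))"
  define d where "d n = \<alpha>2 * norm (T (T (w n)) - T (w n))" for n
  have wC: "\<And>n. w n \<in> C" and lim: "\<epsilon> \<longlonglongrightarrow> 0"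
    using w by (auto simp: approx_fixed_point_seq_def \<epsilon>_def)
  obtain B where B: "\<And>x y. x \<in> C \<Longrightarrow> y \<in> C \<Longrightarrow> norm (x - y) \<le> B"
    using bounded_two_points[of C] \<open>bounded C\<close> by (auto simp: dist_norm)
  have d: "0 \<le> d n" "d n \<le> B" for n
  proof -
    have "d n \<le> 1 * norm (T (T (w n)) - T (w n))"
      unfolding d_def using \<alpha> by (intro mult_right_mono) auto
    also have "\<dots> \<le> B"
      using B wC by (simp add: T_in)
    finally show "d n \<le> B" .
  qed (use \<alpha> in \<open>simp add: d_def\<close>)
  have \<epsilon>: "0 \<le> \<epsilon> n" "\<epsilon> n \<le> B" for n
    using B wC averaged_in by (auto simp: \<epsilon>_def Pi_iff)
  \<comment> \<open>Both \<open>d n + \<epsilon> n\<close> and \<open>d n\<close> must lie in one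
    interval \<open>{0..B + B}\<close>, so that a vanishing difference \<open>\<epsilon> n\<close>
    gives a vanishing difference of powers.\<close>
  have "d n + \<epsilon> n \<le> B + B" "d n \<le> B + B" for n
    using d[of n] \<epsilon>[of n] by linarith+
  then have "(\<lambda>n. (d n + \<epsilon> n) powr p - d n powr p) \<longlonglongrightarrow> 0"
    using d(1) \<epsilon>(1) p lim by (intro powr_diff_tendsto_zero[where M = "B + B"]) auto
  moreover have "\<alpha>2 * norm (T (T (T (w n))) - T (T (w n))) powr p
      \<le> (d n + \<epsilon> n) powr p - d n powr p" for n
  proof -
    have "norm (w n - T (w n)) powr p \<le> (d n + \<epsilon> n) powr p"
      using norm_diff_le_averaged[of "w n"] p unfolding d_def \<epsilon>_def by (intro powr_mono2) auto
    then show ?thesis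
      using third_iterate_le[OF wC le, of n] by (simp add: d_def)
  qed
  ultimately have "(\<lambda>n. \<alpha>2 * norm (T (T (T (w n))) - T (T (w n))) powr p) \<longlonglongrightarrow> 0"
    using \<alpha> by (elim tendsto_0_le[where K = 1]) (simp add: order_trans[OF _ abs_ge_self])
  then have "(\<lambda>n. norm (T (T (T (w n))) - T (T (w n))) powr p) \<longlonglongrightarrow> 0"
    using \<alpha> by (simp add: tendsto_mult_left_iff[of \<alpha>2 _ 0, simplified])
  then have "(\<lambda>n. norm (T (T (T (w n))) - T (T (w n)))) \<longlonglongrightarrow> 0"
    by (rule powr_tendsto_zero_cancel[rotated 2]) (use p in simp_all)
  then show ?thesis
    using wC by (simp add: approx_fixed_point_seq_def T_in)
qed

section \<open>The associated map on pairs\<close>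

definition pair_map :: "'a \<times> 'a \<Rightarrow> 'a \<times> 'a" where
  "pair_map u =
    (T (\<alpha>1 *\<^sub>R fst u + \<alpha>2 *\<^sub>R snd u), T (T (\<alpha>1 *\<^sub>R fst u + \<alpha>2 *\<^sub>R snd u)))"

lemma pair_map_in: "pair_map \<in> C \<times> C \<rightarrow> C \<times> C"
  unfolding pair_map_def by (auto intro!: combination_in T_in)

text \<open>Let \<open>a\<close> and \<open>b\<close> be the weighted means of the two pairs. The
  mean inequality bounds the \<open>p\<close>-th power of the image distance by
  \<open>norm (a - b) powr p\<close>, and convexity bounds this by the \<open>p\<close>-th power of
  the pair norm of \<open>u - v\<close>.\<close>

lemma pair_map_nonexpansive: "nonexpansive_wrt (pair_norm \<alpha>1 \<alpha>2 p) (C \<times> C) pair_map"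
  unfolding nonexpansive_wrt_def
proof (intro ballI)
  fix u v
  assume u: "u \<in> C \<times> C" and v: "v \<in> C \<times> C"
  define a where "a = \<alpha>1 *\<^sub>R fst u + \<alpha>2 *\<^sub>R snd u"
  define b where "b = \<alpha>1 *\<^sub>R fst v + \<alpha>2 *\<^sub>R snd v"
  have "a \<in> C" "b \<in> C"
    using u v by (auto simp: a_def b_def intro: combination_in)
  then have "\<alpha>1 * norm (T a - T b) powr p + \<alpha>2 * norm (T (T a) - T (T b)) powr p
      \<le> norm (a - b) powr p"
    by (rule mean_ineq)
  also have "a - b = \<alpha>1 *\<^sub>R fst (u - v) + \<alpha>2 *\<^sub>R snd (u - v)"
    by (simp add: a_def b_def algebra_simps)
  also have "norm \<dots> powr p \<le> \<alpha>1 * norm (fst (u - v)) powr p + \<alpha>2 * norm (snd (u - v)) powr p"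
    using p \<alpha> by (intro norm_combination_powr_le) auto
  finally show "pair_norm \<alpha>1 \<alpha>2 p (pair_map u - pair_map v) \<le> pair_norm \<alpha>1 \<alpha>2 p (u - v)"
    unfolding pair_norm_def pair_map_def a_def[symmetric] b_def[symmetric]
    using p \<alpha> by (intro powr_mono2) auto
qed

lemma averaged_fixed_point:
  assumes "fixed_point_property (pair_norm \<alpha>1 \<alpha>2 p) (C \<times> C)"
  shows "\<exists>w\<in>C. averaged w = w"
proof -
  obtain x y where xy: "x \<in> C" "y \<in> C" "pair_map (x, y) = (x, y)"
    using assms pair_map_in pair_map_nonexpansive unfolding fixed_point_property_def by blast
  \<comment> \<open>With \<open>w\<close> the weighted mean of \<open>x\<close> and
    \<open>y\<close>, a fixed pair satisfies \<open>x = T w\<close> and \<open>y = T (T w)\<close>.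
    Substituting these into \<open>averaged w\<close> returns the combination that defines
    \<open>w\<close>.\<close>
  then have "T (\<alpha>1 *\<^sub>R x + \<alpha>2 *\<^sub>R y) = x" "T x = y"
    by (auto simp: pair_map_def)
  then have "averaged (\<alpha>1 *\<^sub>R x + \<alpha>2 *\<^sub>R y) = \<alpha>1 *\<^sub>R x + \<alpha>2 *\<^sub>R y"
    by (simp add: averaged_def)
  then show ?thesis
    using xy combination_in by blast
qed

end

theorem corollary3p4:
  fixes C :: "'a::banach set" and T :: "'a \<Rightarrow> 'a" and p \<alpha>1 \<alpha>2 :: real
  assumes "C \<noteq> {}" and "closed C" and "bounded C" and "convex C"
    and "p \<ge> 1"
    and "\<alpha>1 > 0" and "\<alpha>2 > 0" and "\<alpha>1 + \<alpha>2 = 1"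
    and "T \<in> C \<rightarrow> C"
    and "mean_nonexpansive_on \<alpha>1 \<alpha>2 p C T"
  shows "(\<alpha>2 powr p \<le> \<alpha>1 \<longrightarrow> (\<exists>x. approx_fixed_point_seq C T x)) \<and>
         (fixed_point_property (pair_norm \<alpha>1 \<alpha>2 p) (C \<times> C) \<and> \<alpha>2 powr p \<le> \<alpha>1
            \<longrightarrow> (\<exists>x\<in>C. T x = x))"
proof -
  interpret mean_nonexpansive C T p \<alpha>1 \<alpha>2
    using assms by unfold_locales
  have "\<exists>w. approx_fixed_point_seq C averaged w"
    using assms averaged_in averaged_nonexpansive by (intro nonexpansive_approx_fixed_point_seq)
  then have "\<alpha>2 powr p \<le> \<alpha>1 \<longrightarrow> (\<exists>x. approx_fixed_point_seq C T x)"
    using approx_fixed_point_seq_if_averaged[OF \<open>bounded C\<close>] by blast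
  moreover have "\<exists>x\<in>C. T x = x"
    if "fixed_point_property (pair_norm \<alpha>1 \<alpha>2 p) (C \<times> C)" "\<alpha>2 powr p \<le> \<alpha>1"
    using averaged_fixed_point[OF that(1)] fixed_point_if_averaged_fixed_point[OF _ _ that(2)] T_in
    by blast
  ultimately show ?thesis
    by blast
qed

end
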